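(* Let $d\ge1$, let $S=([l_1,u_1]\times\dots\times[l_d,u_d])\cap\mathbb{Z}^d$ be a finite axis-aligned box, equipped with the Euclidean metric $\mathrm{dist}(r,s)=\|r-s\|_2$. Let $\lambda>0$ and let $J$ be a $\mathbb{Z}^d$-valued random variable. Consider the translation-invariant continuous-time Markov chain truncated to $S$ with jump rate $\lambda$ and jump offsets distributed as $J$, and let $Q$ be its generator. Then $\underline{\kappa}(Q)\ge 0$.
   Context: Translation-invariant CTMC truncated to $S$: in every state, jump events occur at rate $\lambda$ (i.i.d. $\mathrm{Exp}(\lambda)$ inter-jump times). At a jump event at time $t$ from state $X_{t^-}\in S$, the new state is $X_t=\rho_S(X_{t^-}+J')$, where $J'$ is a fresh independent copy of $J$ (same distribution for every state) and $\rho_S:\mathbb{Z}^d\to S$ is the closest-point projection onto $S$ for the Euclidean distance. Thus for $r\ne s$ in $S$ the generator is $Q(r,s)=\lambda\,\mathbb{P}[\rho_S(r+J)=s]$, and $Q(r,r)=-\sum_{s\ne r}Q(r,s)$. Assume $S$ has at least two elements. Wasserstein distance: for probability vectors $p,q$ on $S$, $\mathrm{W}_1(p,q)=\min_{\gamma}\sum_{r,s\in S}\mathrm{dist}(r,s)\gamma(r,s)$, the minimum being over all couplings $\gamma$ of $p$ and $q$ (probability measures on $S\times S$ with marginals $p$ and $q$). Coarse Ricci curvature: for $r\ne s$ in $S$, $\kappa(r,s)=-\frac{1}{\mathrm{dist}(r,s)}\frac{\mathrm d}{\mathrm dt}\big|_{t=0^+}\mathrm{W}_1(\delta_r^{\mathsf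 T}e^{tQ},\delta_s^{\mathsf T}e^{tQ})$, where $\delta_r$ is the Dirac vector at $r$ (this right derivative exists), and $\underline\kappa(Q)=\min_{r\ne s}\kappa(r,s)$. *)

theory Defs
  imports "HOL-Probability.Probability"
begin

text \<open>
  Matrices and vectors indexed by a finite set \<open>S\<close> are functions; only their values on \<open>S\<close> are
  ever used.
\<close>

definition int_lattice :: "(real ^ 'n) set" where
  "int_lattice = {x. \<forall>i. x $ i \<in> \<int>}"

definition lattice_box :: "real ^ 'n \<Rightarrow> real ^ 'n \<Rightarrow> (real ^ 'n) set" where
  "lattice_box l u = cbox l u \<inter> int_lattice"

text \<open>
  The projection onto a box is single-valued at lattice points, so the choice made by
  \<^const>\<open>closest_point\<close> is immaterial.
\<close>

definition truncated_generator ::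
  "(real ^ 'n) set \<Rightarrow> real \<Rightarrow> 'w measure \<Rightarrow> ('w \<Rightarrow> real ^ 'n) \<Rightarrow> real ^ 'n \<Rightarrow> real ^ 'n \<Rightarrow> real" where
  "truncated_generator S rate M J r s =
    (let jump = (\<lambda>y. rate * \<P>(\<omega> in M. closest_point S (r + J \<omega>) = y))
     in if r = s then - (\<Sum>y\<in>S - {r}. jump y) else jump s)"

primrec mat_power :: "'a set \<Rightarrow> ('a \<Rightarrow> 'a \<Rightarrow> real) \<Rightarrow> nat \<Rightarrow> 'a \<Rightarrow> 'a \<Rightarrow> real" where
  "mat_power S A 0 = (\<lambda>r s. if r = s then 1 else 0)"
| "mat_power S A (Suc k) = (\<lambda>r s. \<Sum>x\<in>S. A r x * mat_power S A k x s)"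

definition mat_exp :: "'a set \<Rightarrow> ('a \<Rightarrow> 'a \<Rightarrow> real) \<Rightarrow> 'a \<Rightarrow> 'a \<Rightarrow> real" where
  "mat_exp S A r s = (\<Sum>k. mat_power S A k r s / fact k)"

definition dirac_vec :: "'a \<Rightarrow> 'a \<Rightarrow> real" where
  "dirac_vec r x = (if x = r then 1 else 0)"

definition row_vec_mult :: "'a set \<Rightarrow> ('a \<Rightarrow> real) \<Rightarrow> ('a \<Rightarrow> 'a \<Rightarrow> real) \<Rightarrow> 'a \<Rightarrow> real" where
  "row_vec_mult S p A s = (\<Sum>x\<in>S. p x * A x s)"

definition couplings :: "'a set \<Rightarrow> ('a \<Rightarrow> real) \<Rightarrow> ('a \<Rightarrow> real) \<Rightarrow> ('a \<Rightarrow> 'a \<Rightarrow> real) set" where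
  "couplings S p q = {\<gamma>. (\<forall>r\<in>S. \<forall>s\<in>S. 0 \<le> \<gamma> r s) \<and>
     (\<forall>r\<in>S. (\<Sum>s\<in>S. \<gamma> r s) = p r) \<and> (\<forall>s\<in>S. (\<Sum>r\<in>S. \<gamma> r s) = q s)}"

text \<open>
  For probability vectors on a finite \<open>S\<close> the set of couplings is nonempty and compact on
  \<open>S \<times> S\<close>, so this infimum is a minimum.
\<close>

definition wasserstein1 :: "'a::metric_space set \<Rightarrow> ('a \<Rightarrow> real) \<Rightarrow> ('a \<Rightarrow> real) \<Rightarrow> real" where
  "wasserstein1 S p q = (INF \<gamma>\<in>couplings S p q. \<Sum>r\<in>S. \<Sum>s\<in>S. dist r s * \<gamma> r s)"

definition coarse_ricci :: "'a::metric_space set \<Rightarrow> ('a \<Rightarrow> 'a \<Rightarrow> real) \<Rightarrow> 'a \<Rightarrow> 'a \<Rightarrow> real" where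
  "coarse_ricci S Q r s = - (1 / dist r s) *
     vector_derivative
       (\<lambda>t. wasserstein1 S
          (row_vec_mult S (dirac_vec r) (mat_exp S (\<lambda>x y. t * Q x y)))
          (row_vec_mult S (dirac_vec s) (mat_exp S (\<lambda>x y. t * Q x y))))
       (at_right 0)"

definition min_coarse_ricci :: "'a::metric_space set \<Rightarrow> ('a \<Rightarrow> 'a \<Rightarrow> real) \<Rightarrow> real" where
  "min_coarse_ricci S Q = Min {coarse_ricci S Q r s | r s. r \<in> S \<and> s \<in> S \<and> r \<noteq> s}"

end

theory Submission
  imports Defs "HOL-Real_Asymp.Real_Asymp"
begin

text \<open>
  Clamping to an axis-aligned box is non-expansive, so driving the chains from \<open>r\<close> and \<open>s\<close> by the
  same jumps couples the one-step laws \<open>P r\<close> and \<open>P s\<close> at cost at most \<open>dist r s\<close>. Uniformization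
  with \<open>u = rate * t\<close> expresses the law at time \<open>t\<close> as the mixture of the laws \<open>P\<^sup>k r\<close> with Poisson
  weights; up to \<open>O(t\<^sup>2)\<close> it is \<open>(1 - v) \<delta>\<^sub>r + v (P r)\<close> with \<open>v = u / (1 + u)\<close>. Convexity of the
  Wasserstein distance then gives both the existence of the right derivative (difference quotients of
  convex functions are monotone) and its sign.
\<close>

section \<open>The Wasserstein distance on a finite metric space\<close>

definition prob_vec :: "'a set \<Rightarrow> ('a \<Rightarrow> real) \<Rightarrow> bool" where
  "prob_vec S p \<longleftrightarrow> (\<forall>x\<in>S. 0 \<le> p x) \<and> sum p S = 1"

definition cost :: "'a::metric_space set \<Rightarrow> ('a \<Rightarrow> 'a \<Rightarrow> real) \<Rightarrow> real" where
  "cost S \<gamma> = (\<Sum>r\<in>S. \<Sum>s\<in>S. dist r s * \<gamma> r s)"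

definition mixture :: "real \<Rightarrow> ('a \<Rightarrow> real) \<Rightarrow> ('a \<Rightarrow> real) \<Rightarrow> 'a \<Rightarrow> real" where
  "mixture a p q x = (1 - a) * p x + a * q x"

lemma prob_vec_dirac: "finite S \<Longrightarrow> r \<in> S \<Longrightarrow> prob_vec S (dirac_vec r)"
  by (auto simp: prob_vec_def dirac_vec_def sum.delta)

lemma prob_vec_mixture:
  "prob_vec S p \<Longrightarrow> prob_vec S q \<Longrightarrow> 0 \<le> a \<Longrightarrow> a \<le> 1 \<Longrightarrow> prob_vec S (mixture a p q)"
  by (auto simp: prob_vec_def mixture_def sum.distrib sum_distrib_left[symmetric])

lemma cost_nonneg: "\<gamma> \<in> couplings S p q \<Longrightarrow> 0 \<le> cost S \<gamma>"
  unfolding cost_def couplings_def by (auto intro!: sum_nonneg mult_nonneg_nonneg)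

lemma wasserstein1_le_cost:
  assumes "\<gamma> \<in> couplings S p q"
  shows "wasserstein1 S p q \<le> cost S \<gamma>"
  unfolding wasserstein1_def cost_def[symmetric]
  using assms by (intro cINF_lower bdd_belowI2[of _ 0]) (auto simp: cost_nonneg)

text \<open>The independent coupling guarantees that the infimum defining
  \<open>wasserstein1\<close> ranges over a nonempty set, so lower bounds on all costs pass to
  it.\<close>

lemma couplings_product:
  assumes "prob_vec S p" "prob_vec S q"
  shows "(\<lambda>x y. p x * q y) \<in> couplings S p q"
  using assms unfolding couplings_def prob_vec_def
  by (auto simp: sum_distrib_left[symmetric] sum_distrib_right[symmetric])

lemma wasserstein1_ge:
  assumes "prob_vec S p" "prob_vec S q" "\<And>\<gamma>. \<gamma> \<in> couplings S p q \<Longrightarrow> c \<le> cost S \<gamma>"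
  shows "c \<le> wasserstein1 S p q"
  unfolding wasserstein1_def cost_def[symmetric]
  using couplings_product[OF assms(1,2)] assms(3) by (intro cINF_greatest) auto

text \<open>Couplings within any positive margin of the infimum stand in for minimizers, which
  avoids a compactness argument.\<close>

lemma wasserstein1_near_optimal:
  assumes "prob_vec S p" "prob_vec S q" "wasserstein1 S p q < c"
  obtains \<gamma> where "\<gamma> \<in> couplings S p q" "cost S \<gamma> < c"
  using wasserstein1_ge[OF assms(1,2), of c] assms(3) by fastforce

text \<open>Mixing near-optimal couplings with the same weight \<open>a\<close> couples the
  mixtures, and the cost is linear in the coupling.\<close>

lemma wasserstein1_mixture:
  assumes p: "prob_vec S p" "prob_vec S p'" and q: "prob_vec S q" "prob_vec S q'"
    and a: "0 \<le> a" "a \<le> 1"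
  shows "wasserstein1 S (mixture a p p') (mixture a q q')
         \<le> (1 - a) * wasserstein1 S p q + a * wasserstein1 S p' q'"
proof (rule field_le_epsilon)
  fix e :: real assume e: "e > 0"
  obtain \<gamma> where \<gamma>: "\<gamma> \<in> couplings S p q" "cost S \<gamma> < wasserstein1 S p q + e"
    using wasserstein1_near_optimal[OF p(1) q(1), of "wasserstein1 S p q + e"] e by auto
  obtain \<gamma>' where \<gamma>': "\<gamma>' \<in> couplings S p' q'" "cost S \<gamma>' < wasserstein1 S p' q' + e"
    using wasserstein1_near_optimal[OF p(2) q(2), of "wasserstein1 S p' q' + e"] e by auto
  let ?\<mu> = "\<lambda>x y. (1 - a) * \<gamma> x y + a * \<gamma>' x y"
  have "?\<mu> \<in> couplings S (mixture a p p') (mixture a q q')"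
    using \<gamma>(1) \<gamma>'(1) a
    by (auto simp: couplings_def mixture_def sum.distrib sum_distrib_left[symmetric])
  then have "wasserstein1 S (mixture a p p') (mixture a q q') \<le> cost S ?\<mu>"
    by (rule wasserstein1_le_cost)
  also have "\<dots> = (1 - a) * cost S \<gamma> + a * cost S \<gamma>'"
    by (simp add: cost_def sum_distrib_left sum.distrib[symmetric] distrib_left mult_ac)
  also have "\<dots> \<le> (1 - a) * (wasserstein1 S p q + e) + a * (wasserstein1 S p' q' + e)"
    using \<gamma>(2) \<gamma>'(2) a by (intro add_mono mult_left_mono) auto
  also have "\<dots> = (1 - a) * wasserstein1 S p q + a * wasserstein1 S p' q' + e"
    by (simp add: algebra_simps)
  finally show "wasserstein1 S (mixture a p p') (mixture a q q')
      \<le> (1 - a) * wasserstein1 S p q + a * wasserstein1 S p' q' + e" .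
qed

text \<open>A nonnegative entry is at most its row sum and at most its column sum, so a vanishing
  marginal annihilates it.\<close>

lemma couplings_zero:
  assumes "finite S" "\<gamma> \<in> couplings S p q" "x \<in> S" "y \<in> S"
  shows "p x = 0 \<Longrightarrow> \<gamma> x y = 0" "q y = 0 \<Longrightarrow> \<gamma> x y = 0"
proof -
  have nn: "\<And>x y. x \<in> S \<Longrightarrow> y \<in> S \<Longrightarrow> 0 \<le> \<gamma> x y" and "sum (\<gamma> x) S = p x" "(\<Sum>x\<in>S. \<gamma> x y) = q y"
    using assms by (auto simp: couplings_def)
  moreover have "\<gamma> x y \<le> sum (\<gamma> x) S"
    by (rule member_le_sum) (use nn assms in auto)
  moreover have "\<gamma> x y \<le> (\<Sum>x\<in>S. \<gamma> x y)"
    by (rule member_le_sum[where f = "\<lambda>x. \<gamma> x y"]) (use nn assms in auto)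
  ultimately have "\<gamma> x y \<le> p x" "\<gamma> x y \<le> q y" by auto
  then show "p x = 0 \<Longrightarrow> \<gamma> x y = 0" "q y = 0 \<Longrightarrow> \<gamma> x y = 0"
    using nn[OF assms(3,4)] by auto
qed

text \<open>
  Gluing along the middle marginal; where \<open>q y = 0\<close> both couplings vanish, so that \<open>x / 0 = 0\<close> is
  the right value.
\<close>

lemma wasserstein1_triangle:
  assumes S: "finite S" and p: "prob_vec S p" and q: "prob_vec S q" and r: "prob_vec S r"
  shows "wasserstein1 S p r \<le> wasserstein1 S p q + wasserstein1 S q r"
proof (rule field_le_epsilon)
  fix e :: real assume e: "e > 0"
  obtain \<alpha> where \<alpha>: "\<alpha> \<in> couplings S p q" "cost S \<alpha> < wasserstein1 S p q + e / 2"
    using wasserstein1_near_optimal[OF p q, of "wasserstein1 S p q + e / 2"] e by auto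
  obtain \<beta> where \<beta>: "\<beta> \<in> couplings S q r" "cost S \<beta> < wasserstein1 S q r + e / 2"
    using wasserstein1_near_optimal[OF q r, of "wasserstein1 S q r + e / 2"] e by auto
  define \<tau> where "\<tau> x y z = \<alpha> x y * \<beta> y z / q y" for x y z
  have nn: "0 \<le> \<tau> x y z" if "x \<in> S" "y \<in> S" "z \<in> S" for x y z
    using that \<alpha>(1) \<beta>(1) q by (auto simp: \<tau>_def couplings_def prob_vec_def)
  have m1: "(\<Sum>z\<in>S. \<tau> x y z) = \<alpha> x y" if "x \<in> S" "y \<in> S" for x y
  proof -
    have "(\<Sum>z\<in>S. \<tau> x y z) = \<alpha> x y * (\<Sum>z\<in>S. \<beta> y z) / q y"
      by (simp add: \<tau>_def sum_distrib_left sum_divide_distrib)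
    also have "\<dots> = \<alpha> x y"
      using \<beta>(1) that couplings_zero(2)[OF S \<alpha>(1) that] by (auto simp: couplings_def)
    finally show ?thesis .
  qed
  have m2: "(\<Sum>x\<in>S. \<tau> x y z) = \<beta> y z" if "y \<in> S" "z \<in> S" for y z
  proof -
    have "(\<Sum>x\<in>S. \<tau> x y z) = (\<Sum>x\<in>S. \<alpha> x y) * \<beta> y z / q y"
      by (simp add: \<tau>_def sum_distrib_right sum_divide_distrib)
    also have "\<dots> = \<beta> y z"
      using \<alpha>(1) that couplings_zero(1)[OF S \<beta>(1) that] by (auto simp: couplings_def)
    finally show ?thesis .
  qed
  let ?\<mu> = "\<lambda>x z. \<Sum>y\<in>S. \<tau> x y z"
  have "?\<mu> \<in> couplings S p r"
    unfolding couplings_def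
  proof (intro CollectI conjI ballI)
    fix x z assume "x \<in> S" "z \<in> S"
    then show "0 \<le> ?\<mu> x z" by (auto intro: sum_nonneg nn)
  next
    fix x assume x: "x \<in> S"
    have "(\<Sum>z\<in>S. ?\<mu> x z) = (\<Sum>y\<in>S. \<Sum>z\<in>S. \<tau> x y z)" by (rule sum.swap)
    also have "\<dots> = (\<Sum>y\<in>S. \<alpha> x y)" using x by (intro sum.cong) (auto simp: m1)
    finally show "(\<Sum>z\<in>S. ?\<mu> x z) = p x" using \<alpha>(1) x by (auto simp: couplings_def)
  next
    fix z assume z: "z \<in> S"
    have "(\<Sum>x\<in>S. ?\<mu> x z) = (\<Sum>y\<in>S. \<Sum>x\<in>S. \<tau> x y z)" by (rule sum.swap)
    also have "\<dots> = (\<Sum>y\<in>S. \<beta> y z)" using z by (intro sum.cong) (auto simp: m2)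
    finally show "(\<Sum>x\<in>S. ?\<mu> x z) = r z" using \<beta>(1) z by (auto simp: couplings_def)
  qed
  then have "wasserstein1 S p r \<le> cost S ?\<mu>" by (rule wasserstein1_le_cost)
  also have "\<dots> = (\<Sum>x\<in>S. \<Sum>z\<in>S. \<Sum>y\<in>S. dist x z * \<tau> x y z)"
    by (simp add: cost_def sum_distrib_left)
  also have "\<dots> \<le> (\<Sum>x\<in>S. \<Sum>z\<in>S. \<Sum>y\<in>S. (dist x y + dist y z) * \<tau> x y z)"
    by (intro sum_mono mult_right_mono nn dist_triangle)
  also have "\<dots> = (\<Sum>x\<in>S. \<Sum>z\<in>S. \<Sum>y\<in>S. dist x y * \<tau> x y z)
                + (\<Sum>x\<in>S. \<Sum>z\<in>S. \<Sum>y\<in>S. dist y z * \<tau> x y z)"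
    by (simp add: distrib_right sum.distrib)
  also have "(\<Sum>x\<in>S. \<Sum>z\<in>S. \<Sum>y\<in>S. dist x y * \<tau> x y z)
      = (\<Sum>x\<in>S. \<Sum>y\<in>S. dist x y * (\<Sum>z\<in>S. \<tau> x y z))"
    by (subst sum.swap) (simp add: sum_distrib_left)
  also have "\<dots> = cost S \<alpha>" unfolding cost_def by (intro sum.cong refl) (simp add: m1)
  also have "(\<Sum>x\<in>S. \<Sum>z\<in>S. \<Sum>y\<in>S. dist y z * \<tau> x y z)
      = (\<Sum>z\<in>S. \<Sum>y\<in>S. \<Sum>x\<in>S. dist y z * \<tau> x y z)"
    by (subst sum.swap) (intro sum.cong refl sum.swap)
  also have "\<dots> = (\<Sum>y\<in>S. \<Sum>z\<in>S. dist y z * (\<Sum>x\<in>S. \<tau> x y z))"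
    by (subst sum.swap) (simp add: sum_distrib_left)
  also have "\<dots> = cost S \<beta>" unfolding cost_def by (intro sum.cong refl) (simp add: m2)
  finally show "wasserstein1 S p r \<le> wasserstein1 S p q + wasserstein1 S q r + e"
    using \<alpha>(2) \<beta>(2) by linarith
qed

lemma couplings_swap: "\<gamma> \<in> couplings S p q \<Longrightarrow> (\<lambda>x y. \<gamma> y x) \<in> couplings S q p"
  by (auto simp: couplings_def)

lemma cost_swap: "cost S (\<lambda>x y. \<gamma> y x) = cost S \<gamma>"
  unfolding cost_def by (subst sum.swap) (simp add: dist_commute)

lemma wasserstein1_commute:
  assumes "prob_vec S p" "prob_vec S q"
  shows "wasserstein1 S p q = wasserstein1 S q p"
proof -
  have "wasserstein1 S q p \<le> wasserstein1 S p q" if "prob_vec S p" "prob_vec S q" for p q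
  proof (rule wasserstein1_ge[OF that])
    fix \<gamma> assume "\<gamma> \<in> couplings S p q"
    from wasserstein1_le_cost[OF couplings_swap[OF this]] show "wasserstein1 S q p \<le> cost S \<gamma>"
      by (simp only: cost_swap[of S \<gamma>])
  qed
  then show ?thesis using assms by (simp add: antisym)
qed

text \<open>The common part \<open>(1 - w) * p\<close> stays in place at no cost; only the remaining
  mass \<open>w\<close> has to travel, and no distance exceeds \<open>D\<close>.\<close>

lemma wasserstein1_perturb:
  assumes S: "finite S" and p: "prob_vec S p" "prob_vec S p'"
    and le: "\<And>x. x \<in> S \<Longrightarrow> (1 - w) * p x \<le> p' x" and w: "w \<le> 1"
    and D: "\<And>x y. x \<in> S \<Longrightarrow> y \<in> S \<Longrightarrow> dist x y \<le> D"
  shows "wasserstein1 S p p' \<le> w * D"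
proof -
  \<comment> \<open>The excess of \<open>p'\<close> over the common part has total mass
    \<open>w\<close> and is drawn independently of the source. Row \<open>x\<close> then sums to (1
    - w) p(x) + w p(x), and the excess completes column \<open>y\<close> to p'(y).\<close>
  let ?\<gamma> = "\<lambda>x y. (if x = y then (1 - w) * p x else 0) + p x * (p' y - (1 - w) * p y)"
  have sum_p: "sum p S = 1" "sum p' S = 1" using p by (auto simp: prob_vec_def)
  then have rest: "(\<Sum>y\<in>S. p' y - (1 - w) * p y) = w"
    by (simp add: sum_subtractf sum_distrib_left[symmetric])
  have "?\<gamma> \<in> couplings S p p'"
    unfolding couplings_def
  proof (intro CollectI conjI ballI)
    fix x y assume "x \<in> S" "y \<in> S"
    then show "0 \<le> ?\<gamma> x y" using p le w by (auto simp: prob_vec_def)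
  next
    fix x assume "x \<in> S"
    then show "(\<Sum>y\<in>S. ?\<gamma> x y) = p x"
      using S by (simp add: sum.distrib sum_distrib_left[symmetric] rest) (simp add: algebra_simps)
  next
    fix y assume "y \<in> S"
    then show "(\<Sum>x\<in>S. ?\<gamma> x y) = p' y"
      using S by (simp add: sum.distrib sum_distrib_right[symmetric] sum_p)
  qed
  then have "wasserstein1 S p p' \<le> cost S ?\<gamma>" by (rule wasserstein1_le_cost)
  also have "\<dots> = (\<Sum>x\<in>S. \<Sum>y\<in>S. dist x y * (p x * (p' y - (1 - w) * p y)))"
    unfolding cost_def by (intro sum.cong refl) auto
  also have "\<dots> \<le> (\<Sum>x\<in>S. \<Sum>y\<in>S. D * (p x * (p' y - (1 - w) * p y)))"
    using p le by (intro sum_mono mult_right_mono D) (auto simp: prob_vec_def)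
  also have "\<dots> = D * (sum p S * (\<Sum>y\<in>S. p' y - (1 - w) * p y))"
    by (subst sum_product) (simp add: sum_distrib_left)
  finally show ?thesis unfolding rest sum_p by (simp add: mult.commute)
qed

lemma wasserstein1_perturb2:
  assumes S: "finite S" and p: "prob_vec S p" "prob_vec S p'" and q: "prob_vec S q" "prob_vec S q'"
    and le: "\<And>x. x \<in> S \<Longrightarrow> (1 - w) * p x \<le> p' x" "\<And>x. x \<in> S \<Longrightarrow> (1 - w) * q x \<le> q' x"
    and w: "w \<le> 1" and D: "\<And>x y. x \<in> S \<Longrightarrow> y \<in> S \<Longrightarrow> dist x y \<le> D"
  shows "\<bar>wasserstein1 S p' q' - wasserstein1 S p q\<bar> \<le> 2 * w * D"
proof -
  note t = wasserstein1_triangle[OF S]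
  have "wasserstein1 S p p' \<le> w * D" "wasserstein1 S q q' \<le> w * D"
    using wasserstein1_perturb[OF S p le(1) w D] wasserstein1_perturb[OF S q le(2) w D] by auto
  then show ?thesis
    using t[OF p(1) p(2) q(1)] t[OF p(2) q(2) q(1)] t[OF p(2) p(1) q(2)] t[OF p(1) q(1) q(2)]
      wasserstein1_commute[OF p] wasserstein1_commute[OF q] by linarith
qed

text \<open>Every coupling of two Dirac vectors puts its whole mass on the pair
  \<open>(r, s)\<close>.\<close>

lemma dist_le_wasserstein1_dirac:
  assumes S: "finite S" and rs: "r \<in> S" "s \<in> S"
  shows "dist r s \<le> wasserstein1 S (dirac_vec r) (dirac_vec s)"
proof (rule wasserstein1_ge)
  fix \<gamma> assume \<gamma>: "\<gamma> \<in> couplings S (dirac_vec r) (dirac_vec s)"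
  have 0: "\<gamma> x y = 0" if "x \<in> S" "y \<in> S" "y \<noteq> s" for x y
    using couplings_zero(2)[OF S \<gamma>] that by (auto simp: dirac_vec_def)
  have "1 = (\<Sum>y\<in>S. \<gamma> r y)" using \<gamma> rs by (auto simp: couplings_def dirac_vec_def)
  also have "\<dots> = \<gamma> r s"
    using sum.remove[OF S rs(2), of "\<gamma> r"] 0 rs by simp
  finally have "dist r s = dist r s * \<gamma> r s" by simp
  also have "\<dots> \<le> (\<Sum>y\<in>S. dist r y * \<gamma> r y)"
    using \<gamma> rs by (intro member_le_sum[OF rs(2)] S) (auto simp: couplings_def)
  also have "\<dots> \<le> cost S \<gamma>"
    unfolding cost_def using \<gamma> rs
    by (intro member_le_sum[OF rs(1), where f = "\<lambda>x. \<Sum>y\<in>S. dist x y * \<gamma> x y"] S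
        sum_nonneg mult_nonneg_nonneg)
      (auto simp: couplings_def)
  finally show "dist r s \<le> cost S \<gamma>" .
qed (simp_all add: prob_vec_dirac[OF S] rs)

section \<open>Uniformization\<close>

text \<open>Pascal's rule summed against an arbitrary \<open>f\<close>: the induction step of the
  binomial theorem, with both exponents kept as arguments of \<open>f\<close>.\<close>

lemma sum_choose_Suc:
  fixes f :: "nat \<Rightarrow> nat \<Rightarrow> real"
  shows "(\<Sum>j\<le>Suc k. real (Suc k choose j) * f j (Suc k - j))
       = (\<Sum>j\<le>k. real (k choose j) * (f (Suc j) (k - j) + f j (Suc (k - j))))"
proof -
  have "(\<Sum>j\<le>Suc k. real (Suc k choose j) * f j (Suc k - j))
      = f 0 (Suc k) + (\<Sum>j\<le>k. real (k choose j) * f (Suc j) (k - j))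
        + (\<Sum>j\<le>k. real (k choose Suc j) * f (Suc j) (k - j))"
    by (simp add: sum.atMost_Suc_shift distrib_right sum.distrib del: sum.atMost_Suc)
  also have "f 0 (Suc k) + (\<Sum>j\<le>k. real (k choose j) * f (Suc j) (k - j))
        + (\<Sum>j\<le>k. real (k choose Suc j) * f (Suc j) (k - j))
      = (\<Sum>j\<le>Suc k. real (k choose j) * f j (Suc k - j))
        + (\<Sum>j\<le>k. real (k choose j) * f (Suc j) (k - j))"
    using sum.atMost_Suc_shift[of "\<lambda>j. real (k choose j) * f j (Suc k - j)" k]
    by (simp del: sum.atMost_Suc)
  \<comment> \<open>The extra summand at \<open>j = Suc k\<close> carries the coefficient
    \<open>k choose Suc k\<close>, which is 0.\<close>
  also have "(\<Sum>j\<le>Suc k. real (k choose j) * f j (Suc k - j))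
      = (\<Sum>j\<le>k. real (k choose j) * f j (Suc (k - j)))"
    by (auto simp: Suc_diff_le intro!: sum.cong)
  finally show ?thesis by (simp add: sum.distrib distrib_left)
qed

text \<open>The binomial theorem for the commuting matrices uP and -uI, read entrywise;
  \<open>dirac_vec\<close> supplies the entries of the identity I.\<close>

lemma mat_power_affine:
  assumes S: "finite S" and A: "\<And>x y. x \<in> S \<Longrightarrow> y \<in> S \<Longrightarrow> A x y = u * (P x y - dirac_vec x y)"
    and "r \<in> S" "s \<in> S"
  shows "mat_power S A k r s
       = (\<Sum>j\<le>k. real (k choose j) * (u ^ j * mat_power S P j r s * (- u) ^ (k - j)))"
  using \<open>r \<in> S\<close>
proof (induction k arbitrary: r)
  case 0
  then show ?case by simp
next
  case (Suc k)
  let ?M = "\<lambda>x. \<Sum>j\<le>k. real (k choose j) * (u ^ j * mat_power S P j x s * (- u) ^ (k - j))"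
  have "mat_power S A (Suc k) r s = (\<Sum>x\<in>S. u * (P r x - dirac_vec r x) * ?M x)"
    by (simp add: Suc A)
  also have "\<dots> = u * (\<Sum>x\<in>S. P r x * ?M x) - u * (\<Sum>x\<in>S. dirac_vec r x * ?M x)"
    by (simp add: sum_distrib_left sum_subtractf left_diff_distrib right_diff_distrib mult.assoc)
  also have "(\<Sum>x\<in>S. dirac_vec r x * ?M x) = (\<Sum>x\<in>S. if x = r then ?M x else 0)"
    by (intro sum.cong) (auto simp: dirac_vec_def)
  also have "\<dots> = ?M r" using S Suc.prems by simp
  also have "(\<Sum>x\<in>S. P r x * ?M x)
      = (\<Sum>j\<le>k. real (k choose j) * (u ^ j * mat_power S P (Suc j) r s * (- u) ^ (k - j)))"
    unfolding sum_distrib_left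
    by (subst sum.swap) (simp add: sum_distrib_left sum_distrib_right mult_ac)
  also have "u * \<dots> - u * ?M r
      = (\<Sum>j\<le>k. real (k choose j) * (u ^ Suc j * mat_power S P (Suc j) r s * (- u) ^ (k - j)
           + u ^ j * mat_power S P j r s * (- u) ^ Suc (k - j)))"
    by (simp add: sum_distrib_left sum_subtractf[symmetric] algebra_simps del: mat_power.simps)
  also have "\<dots> = (\<Sum>j\<le>Suc k. real (Suc k choose j) *
      (u ^ j * mat_power S P j r s * (- u) ^ (Suc k - j)))"
    by (rule sum_choose_Suc[symmetric])
  finally show ?case .
qed

locale stochastic_matrix =
  fixes S :: "'a set" and P :: "'a \<Rightarrow> 'a \<Rightarrow> real"
  assumes finite_S: "finite S"
    and prob_row: "r \<in> S \<Longrightarrow> prob_vec S (P r)"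
begin

lemma prob_vec_mat_power:
  assumes "r \<in> S"
  shows "prob_vec S (mat_power S P k r)"
  using assms
proof (induction k arbitrary: r)
  case 0
  then show ?case using finite_S by (auto simp: prob_vec_def)
next
  case (Suc k)
  have "(\<Sum>y\<in>S. \<Sum>x\<in>S. P r x * mat_power S P k x y)
      = (\<Sum>x\<in>S. P r x * (\<Sum>y\<in>S. mat_power S P k x y))"
    by (subst sum.swap) (simp add: sum_distrib_left)
  also have "\<dots> = 1" using Suc prob_row by (auto simp: prob_vec_def)
  finally show ?case
    using Suc prob_row by (auto simp: prob_vec_def intro!: sum_nonneg)
qed

text \<open>The factor \<open>exp (- u)\<close> is left to \<open>poisson_law\<close>, so that in
  the Cauchy product for the matrix exponential it can arise from a series of its own.\<close>

definition poisson_term :: "real \<Rightarrow> nat \<Rightarrow> 'a \<Rightarrow> 'a \<Rightarrow> real" where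
  "poisson_term u k r s = u ^ k * mat_power S P k r s / fact k"

definition poisson_law :: "real \<Rightarrow> 'a \<Rightarrow> 'a \<Rightarrow> real" where
  "poisson_law u r s = exp (- u) * (\<Sum>k. poisson_term u k r s)"

lemma poisson_term_nonneg: "0 \<le> u \<Longrightarrow> r \<in> S \<Longrightarrow> s \<in> S \<Longrightarrow> 0 \<le> poisson_term u k r s"
  using prob_vec_mat_power[of r k] by (auto simp: poisson_term_def prob_vec_def)

lemma sums_exp: "(\<lambda>k. u ^ k / fact k) sums exp (u::real)"
  using exp_converges[of u] by (simp add: divide_inverse mult.commute)

lemma summable_poisson_term:
  assumes "0 \<le> u" "r \<in> S" "s \<in> S"
  shows "summable (\<lambda>k. poisson_term u k r s)"
proof (rule summable_comparison_test')
  show "summable (\<lambda>k. u ^ k / fact k)" using sums_exp by (rule sums_summable)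
  fix k
  have "mat_power S P k r s \<le> sum (mat_power S P k r) S"
    using prob_vec_mat_power[OF assms(2)] finite_S assms(3)
    by (intro member_le_sum) (auto simp: prob_vec_def)
  then have "mat_power S P k r s \<le> 1"
    using prob_vec_mat_power[OF assms(2)] by (simp add: prob_vec_def)
  then have "poisson_term u k r s \<le> u ^ k / fact k"
    using assms(1) unfolding poisson_term_def
    by (intro divide_right_mono) (auto intro: mult_left_le)
  then show "norm (poisson_term u k r s) \<le> u ^ k / fact k"
    using poisson_term_nonneg[OF assms] by simp
qed

text \<open>Since I commutes with P, exp(u(P - I)) = exp(-u) exp(uP). Entrywise this is a Cauchy
  product of two scalar series, because (k choose j) / k! = 1 / (j! (k - j)!).\<close>

lemma mat_exp_eq_poisson_law:
  assumes A: "\<And>x y. x \<in> S \<Longrightarrow> y \<in> S \<Longrightarrow> A x y = u * (P x y - dirac_vec x y)"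
    and u: "0 \<le> u" and rs: "r \<in> S" "s \<in> S"
  shows "mat_exp S A r s = poisson_law u r s"
proof -
  let ?a = "\<lambda>k. poisson_term u k r s" and ?b = "\<lambda>k. (- u) ^ k / fact k"
  have "mat_power S A k r s
      = (\<Sum>j\<le>k. real (k choose j) * (u ^ j * mat_power S P j r s * (- u) ^ (k - j)))" for k
    by (rule mat_power_affine[OF finite_S _ rs]) (rule A)
  then have "mat_power S A k r s / fact k = (\<Sum>j\<le>k. ?a j * ?b (k - j))" for k
    by (simp only: sum_divide_distrib, intro sum.cong) (auto simp: poisson_term_def binomial_fact field_simps)
  moreover have "(\<lambda>k. \<Sum>j\<le>k. ?a j * ?b (k - j)) sums (suminf ?a * suminf ?b)"
  proof (rule Cauchy_product_sums)
    show "summable (\<lambda>k. norm (?a k))"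
      using summable_poisson_term[OF u rs] poisson_term_nonneg[OF u rs] by simp
    show "summable (\<lambda>k. norm (?b k))"
      using sums_summable[OF sums_exp[of "\<bar>u\<bar>"]] by (simp add: power_abs)
  qed
  ultimately show ?thesis
    using sums_exp[of "- u"] by (simp add: mat_exp_def poisson_law_def sums_iff mult.commute)
qed

lemma prob_vec_poisson_law:
  assumes u: "0 \<le> u" and r: "r \<in> S"
  shows "prob_vec S (poisson_law u r)"
proof -
  have "(\<Sum>s\<in>S. \<Sum>k. poisson_term u k r s) = (\<Sum>k. \<Sum>s\<in>S. poisson_term u k r s)"
    using summable_poisson_term[OF u r] by (intro suminf_sum[symmetric]) auto
  also have "\<dots> = (\<Sum>k. u ^ k / fact k)"
    using prob_vec_mat_power[OF r]
    by (simp add: poisson_term_def prob_vec_def sum_distrib_left[symmetric]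
        sum_divide_distrib[symmetric])
  also have "\<dots> = exp u" using sums_exp by (simp add: sums_iff)
  finally have "sum (poisson_law u r) S = 1"
    by (simp add: poisson_law_def sum_distrib_left[symmetric] exp_minus)
  then show ?thesis
    using poisson_term_nonneg[OF u r] summable_poisson_term[OF u r]
    by (auto simp: prob_vec_def poisson_law_def intro!: mult_nonneg_nonneg suminf_nonneg)
qed

text \<open>Dropping all Poisson terms with two or more jumps leaves weights 1 and u on zero and one
  jump, up to the factor exp(-u). Normalizing by 1 + u gives the mixture weight
  \<open>u / (1 + u)\<close>.\<close>

lemma poisson_law_ge:
  assumes u: "0 \<le> u" and rs: "r \<in> S" "s \<in> S"
  shows "exp (- u) * (1 + u) * mixture (u / (1 + u)) (dirac_vec r) (P r) s \<le> poisson_law u r s"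
proof -
  have "(\<Sum>x\<in>S. P r x * (if x = s then 1 else 0)) = (\<Sum>x\<in>S. if x = s then P r x else 0)"
    by (intro sum.cong) auto
  also have "\<dots> = P r s" using finite_S rs by simp
  finally have "poisson_term u 1 r s = u * P r s"
    by (simp add: poisson_term_def)
  moreover have "poisson_term u 0 r s = dirac_vec r s"
    by (simp add: poisson_term_def dirac_vec_def)
  moreover have "(\<Sum>k<2. poisson_term u k r s) \<le> (\<Sum>k. poisson_term u k r s)"
    using poisson_term_nonneg[OF u rs] by (intro sum_le_suminf summable_poisson_term u rs) auto
  ultimately have "dirac_vec r s + u * P r s \<le> (\<Sum>k. poisson_term u k r s)"
    by (simp add: numeral_2_eq_2)
  moreover have "(1 + u) * mixture (u / (1 + u)) (dirac_vec r) (P r) s = dirac_vec r s + u * P r s"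
    proof -
    have "(1 + u) * (u / (1 + u)) = u" using u by simp
    then have "(1 + u) * (1 - u / (1 + u)) = 1" by (simp only: right_diff_distrib) simp
    with \<open>(1 + u) * (u / (1 + u)) = u\<close> show ?thesis
      by (simp only: mixture_def distrib_left mult.assoc[symmetric] mult_1)
  qed
  ultimately show ?thesis
    by (simp add: poisson_law_def mult.assoc)
qed

end

section \<open>Curvature of a jump chain\<close>

text \<open>\<open>vector_derivative\<close> is a choice operator, so \<open>coarse_ricci\<close>
  has a usable value only once the limit of the difference quotients is exhibited.\<close>

lemma vector_derivative_at_right_eqI:
  fixes f :: "real \<Rightarrow> real"
  assumes "((\<lambda>t. (f t - f 0) / t) \<longlongrightarrow> L) (at_right 0)"
  shows "vector_derivative f (at_right 0) = L"
proof (rule vector_derivative_within)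
  show "(f has_vector_derivative L) (at_right 0)"
    using assms
    by (simp add: has_real_derivative_iff_has_vector_derivative[symmetric] has_field_derivative_iff)
qed simp

text \<open>Convexity along chords starting at 0 makes the slope from 0 nondecreasing in
  \<open>a\<close>, and \<open>lower\<close> bounds it below by \<open>- C\<close>; its right limit
  at 0 is therefore its infimum.\<close>

lemma convex_slope_limit:
  fixes g :: "real \<Rightarrow> real"
  assumes conv: "\<And>a b. 0 < a \<Longrightarrow> a \<le> b \<Longrightarrow> b \<le> 1 \<Longrightarrow> g a \<le> (1 - a / b) * g 0 + (a / b) * g b"
    and lower: "\<And>a. 0 < a \<Longrightarrow> a \<le> 1 \<Longrightarrow> g 0 - C * a \<le> g a"
  obtains L where "((\<lambda>a. (g a - g 0) / a) \<longlongrightarrow> L) (at_right 0)"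
proof -
  let ?h = "\<lambda>a. (g a - g 0) / a"
  have "(?h \<longlongrightarrow> Inf (?h ` ({0<..} \<inter> {0<..<1}))) (at 0 within ({0<..} \<inter> {0<..<1}))"
  proof (rule Lim_right_bound)
    fix a b :: real assume "a \<in> {0<..<1}" "b \<in> {0<..<1}" "a \<le> b"
    then show "?h a \<le> ?h b" using conv[of a b] by (simp add: field_simps)
  next
    fix a :: real assume "a \<in> {0<..<1}"
    then show "- C \<le> ?h a" using lower[of a] by (simp add: field_simps)
  qed
  moreover have "{0<..} \<inter> {0<..<1} = {0<..<1::real}" by auto
  moreover have "at 0 within {0<..<1::real} = at_right 0"
    by (rule at_within_nhd[of _ "{-1<..<1}"]) auto
  ultimately have "(?h \<longlongrightarrow> Inf (?h ` {0<..<1})) (at_right 0)" by (simp only:)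
  then show ?thesis by (rule that)
qed

text \<open>Separates analysis from geometry: the box will enter only through the one-step
  contraction \<open>contr\<close>, while the argument works for any stochastic matrix on a finite
  subset of a metric space.\<close>

lemma coarse_ricci_nonneg:
  fixes S :: "'a::metric_space set"
  assumes "stochastic_matrix S P"
    and contr: "\<And>x y. x \<in> S \<Longrightarrow> y \<in> S \<Longrightarrow> wasserstein1 S (P x) (P y) \<le> dist x y"
    and rate: "rate > 0"
    and Q: "\<And>x y. x \<in> S \<Longrightarrow> y \<in> S \<Longrightarrow> Q x y = rate * (P x y - dirac_vec x y)"
    and rs: "r \<in> S" "s \<in> S"
  shows "0 \<le> coarse_ricci S Q r s"
proof -
  interpret stochastic_matrix S P by fact
  define D where "D = diameter S"
  have D: "dist x y \<le> D" if "x \<in> S" "y \<in> S" for x y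
    unfolding D_def using that finite_S by (intro diameter_bounded_bound finite_imp_bounded)
  let ?m = "\<lambda>v x. mixture v (dirac_vec x) (P x)"
  define g where "g v = wasserstein1 S (?m v r) (?m v s)" for v
  define W where "W t = wasserstein1 S
          (row_vec_mult S (dirac_vec r) (mat_exp S (\<lambda>x y. t * Q x y)))
          (row_vec_mult S (dirac_vec s) (mat_exp S (\<lambda>x y. t * Q x y)))" for t
  have pm: "prob_vec S (?m v x)" if "0 \<le> v" "v \<le> 1" "x \<in> S" for v x
    using that finite_S by (intro prob_vec_mixture prob_vec_dirac prob_row) auto
  have m0: "?m 0 x = dirac_vec x" for x by (simp add: mixture_def fun_eq_iff)
  have conv: "g a \<le> (1 - a / b) * g 0 + (a / b) * g b" if "0 < a" "a \<le> b" "b \<le> 1" for a b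
  proof -
    \<comment> \<open>The law \<open>?m v x\<close> is affine in \<open>v\<close>, so the point
      \<open>a\<close> sits at fraction \<open>a / b\<close> of the chord from 0 to
      \<open>b\<close>.\<close>
    have eq: "?m a x = mixture (a / b) (?m 0 x) (?m b x)" for x
      using that by (simp add: mixture_def fun_eq_iff field_simps)
    show ?thesis
      unfolding g_def eq using that rs by (intro wasserstein1_mixture pm) auto
  qed
  \<comment> \<open>The mixture with weight \<open>a\<close> dominates (1 - a) times the Dirac
    vector, so the perturbation bound applies with \<open>w = a\<close>.\<close>
  have close: "\<bar>g a - g 0\<bar> \<le> 2 * a * D" if "0 < a" "a \<le> 1" for a
    unfolding g_def using that rs
    by (intro wasserstein1_perturb2 pm finite_S D)
      (use that prob_row in \<open>auto simp: mixture_def prob_vec_def\<close>)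
  obtain L where L: "((\<lambda>a. (g a - g 0) / a) \<longlongrightarrow> L) (at_right 0)"
  proof (rule convex_slope_limit[of g "2 * D"])
    show "g 0 - 2 * D * a \<le> g a" if "0 < a" "a \<le> 1" for a
      using close[OF that] by (simp add: mult_ac)
  qed (use conv in auto)
  \<comment> \<open>The chord to \<open>b = 1\<close> ends at the distance between
    \<open>P r\<close> and \<open>P s\<close>, which contraction bounds by \<open>dist r s\<close>,
    hence by \<open>g 0\<close>.\<close>
  have "(g a - g 0) / a \<le> 0" if "0 < a" "a < 1" for a
  proof -
    have "g a \<le> (1 - a) * g 0 + a * wasserstein1 S (P r) (P s)"
      using conv[of a 1] that by (simp add: g_def mixture_def[abs_def])
    also have "wasserstein1 S (P r) (P s) \<le> g 0"
      using contr[OF rs] dist_le_wasserstein1_dirac[OF finite_S rs] by (simp add: g_def m0)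
    finally have "g a \<le> g 0" using that by (simp add: algebra_simps)
    then show ?thesis using that by (simp add: divide_nonpos_pos)
  qed
  then have "L \<le> 0"
    by (intro tendsto_upperbound[OF L])
      (auto simp: eventually_at_right_field intro!: exI[of _ 1])

  \<comment> \<open>For a Poisson count with mean \<open>rate * t\<close>, \<open>?v t\<close> is
    the probability of one jump given at most one, and \<open>?w t\<close> the probability of at
    least two, which is O(t^2).\<close>
  let ?v = "\<lambda>t. rate * t / (1 + rate * t)"
  let ?w = "\<lambda>t. 1 - exp (- (rate * t)) * (1 + rate * t)"
  have law: "row_vec_mult S (dirac_vec x) (mat_exp S (\<lambda>x y. t * Q x y)) y = poisson_law (rate * t) x y"
    if "x \<in> S" "y \<in> S" "0 \<le> t" for x y t
  proof -
    have "row_vec_mult S (dirac_vec x) (mat_exp S (\<lambda>x y. t * Q x y)) y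
        = (\<Sum>z\<in>S. if z = x then mat_exp S (\<lambda>x y. t * Q x y) z y else 0)"
      unfolding row_vec_mult_def by (intro sum.cong) (auto simp: dirac_vec_def)
    also have "\<dots> = mat_exp S (\<lambda>x y. t * Q x y) x y" using that finite_S by simp
    also have "\<dots> = poisson_law (rate * t) x y"
      using that rate by (intro mat_exp_eq_poisson_law) (auto simp: Q)
    finally show ?thesis .
  qed
  have W_eq: "W t = wasserstein1 S (poisson_law (rate * t) r) (poisson_law (rate * t) s)"
    if "0 \<le> t" for t
    unfolding W_def wasserstein1_def couplings_def using that rs by (simp add: law cong: conj_cong)
  have W_close: "\<bar>W t - g (?v t)\<bar> \<le> 2 * ?w t * D" if t: "0 \<le> t" for t
    unfolding W_eq[OF t] g_def
  proof (rule wasserstein1_perturb2[OF finite_S])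
    have u: "0 \<le> rate * t" using t rate by simp
    then have v: "0 \<le> ?v t" "?v t \<le> 1" by (auto simp: divide_simps)
    show "prob_vec S (?m (?v t) r)" "prob_vec S (?m (?v t) s)" using pm v rs by auto
    show "prob_vec S (poisson_law (rate * t) r)" "prob_vec S (poisson_law (rate * t) s)"
      using prob_vec_poisson_law u rs by auto
    show "?w t \<le> 1" using u by simp
    show "(1 - ?w t) * ?m (?v t) r x \<le> poisson_law (rate * t) r x"
      "(1 - ?w t) * ?m (?v t) s x \<le> poisson_law (rate * t) s x" if "x \<in> S" for x
      using poisson_law_ge[OF u _ that] rs by auto
  qed (use D in auto)
  \<comment> \<open>At \<open>t = 0\<close> both \<open>?v t\<close> and \<open>?w t\<close>
    vanish.\<close>
  have W0: "W 0 = g 0" using W_close[of 0] by simp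
  have "((\<lambda>t. (g (?v t) - g 0) / ?v t) \<longlongrightarrow> L) (at_right 0)"
  proof (rule filterlim_compose[OF L])
    show "filterlim ?v (at_right 0) (at_right 0)" using rate by real_asymp
  qed
  moreover have "((\<lambda>t. rate / (1 + rate * t)) \<longlongrightarrow> rate) (at_right 0)"
    using rate by real_asymp
  moreover have "((\<lambda>t. (W t - g (?v t)) / t) \<longlongrightarrow> 0) (at_right 0)"
  proof (rule Lim_null_comparison)
    show "((\<lambda>t. 2 * ?w t * D / t) \<longlongrightarrow> 0) (at_right 0)" using rate by real_asymp
    show "\<forall>\<^sub>F t in at_right 0. norm ((W t - g (?v t)) / t) \<le> 2 * ?w t * D / t"
      using W_close
      by (auto simp: eventually_at_right_field intro!: exI[of _ 1] divide_right_mono)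
  qed
  \<comment> \<open>The quotient of \<open>W\<close> splits into the slope of \<open>g\<close> at
    \<open>?v t\<close>, times \<open>?v t / t\<close>, plus the error from two or more jumps
    divided by \<open>t\<close>.\<close>
  ultimately have "((\<lambda>t. (g (?v t) - g 0) / ?v t * (rate / (1 + rate * t)) + (W t - g (?v t)) / t)
      \<longlongrightarrow> L * rate + 0) (at_right 0)"
    by (intro tendsto_intros)
  moreover have "\<forall>\<^sub>F t in at_right 0.
      (g (?v t) - g 0) / ?v t * (rate / (1 + rate * t)) + (W t - g (?v t)) / t = (W t - W 0) / t"
  proof -
    have "(g (?v t) - g 0) / ?v t * (rate / (1 + rate * t)) + (W t - g (?v t)) / t
        = (W t - W 0) / t" if "0 < t" for t
    proof -
      have "0 < 1 + rate * t" using that rate by (simp add: add_pos_pos)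
      then have "rate / (1 + rate * t) = ?v t / t" "?v t \<noteq> 0" using that rate by auto
      then have "(g (?v t) - g 0) / ?v t * (rate / (1 + rate * t)) = (g (?v t) - g 0) / t"
        by simp
      then show ?thesis by (simp add: W0 add_divide_distrib[symmetric])
    qed
    then show ?thesis by (auto simp: eventually_at_right_field intro!: exI[of _ 1])
  qed
  ultimately have "((\<lambda>t. (W t - W 0) / t) \<longlongrightarrow> L * rate + 0) (at_right 0)"
    by (rule Lim_transform_eventually)
  then have "vector_derivative W (at_right 0) = L * rate + 0"
    by (rule vector_derivative_at_right_eqI)
  then have "coarse_ricci S Q r s = - (1 / dist r s) * (L * rate)"
    by (simp add: coarse_ricci_def W_def[abs_def])
  then show ?thesis
    using \<open>L \<le> 0\<close> rate by (simp add: divide_nonpos_nonneg mult_nonpos_nonneg)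
qed

section \<open>Projection onto a lattice box\<close>

text \<open>The corners \<open>l\<close> and \<open>u\<close> may be non-integral. Rounding them
  inwards leaves the same lattice points and lets clamping preserve integrality.\<close>

definition box_clamp :: "real ^ 'n \<Rightarrow> real ^ 'n \<Rightarrow> real ^ 'n \<Rightarrow> real ^ 'n" where
  "box_clamp l u z = (\<chi> i. max (of_int \<lceil>l $ i\<rceil>) (min (of_int \<lfloor>u $ i\<rfloor>) (z $ i)))"

text \<open>Each coordinate is clamped separately by a 1-Lipschitz map, and the Euclidean norm is
  monotone in the absolute coordinates.\<close>

lemma dist_box_clamp_le: "dist (box_clamp l u x) (box_clamp l u y) \<le> dist x y"
  unfolding dist_vec_def by (intro L2_set_mono) (auto simp: box_clamp_def dist_real_def)

lemma lattice_box_iff: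
  "x \<in> lattice_box l u \<longleftrightarrow>
     (\<forall>i. x $ i \<in> \<int> \<and> of_int \<lceil>l $ i\<rceil> \<le> x $ i \<and> x $ i \<le> of_int \<lfloor>u $ i\<rfloor>)"
proof -
  have "a \<in> \<int> \<and> of_int \<lceil>b\<rceil> \<le> a \<and> a \<le> of_int \<lfloor>c\<rfloor> \<longleftrightarrow> a \<in> \<int> \<and> b \<le> a \<and> a \<le> c" for a b c :: real
    by (auto elim!: Ints_cases simp: ceiling_le_iff le_floor_iff)
  then show ?thesis
    by (auto simp: lattice_box_def int_lattice_def mem_box_cart)
qed

lemma box_clamp_in_lattice_box:
  assumes "x \<in> lattice_box l u" "z \<in> int_lattice"
  shows "box_clamp l u z \<in> lattice_box l u"
  unfolding lattice_box_iff
proof (intro allI conjI)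
  fix i
  show "box_clamp l u z $ i \<in> \<int>"
    using assms(2) by (auto simp: box_clamp_def int_lattice_def max_def min_def)
  have "of_int \<lceil>l $ i\<rceil> \<le> (of_int \<lfloor>u $ i\<rfloor> :: real)"
    using assms(1) unfolding lattice_box_iff by (meson order_trans)
  then show "of_int \<lceil>l $ i\<rceil> \<le> box_clamp l u z $ i" "box_clamp l u z $ i \<le> of_int \<lfloor>u $ i\<rfloor>"
    by (auto simp: box_clamp_def)
qed

text \<open>Write c for the closest point and y for the clamp. Expanding |c - z|^2 around y gives |c
  - y|^2 + |y - z|^2 plus a nonnegative inner product, so minimality of c forces c = y.\<close>

lemma closest_point_lattice_box:
  assumes fin: "finite (lattice_box l u)" and x: "x \<in> lattice_box l u" and z: "z \<in> int_lattice"
  shows "closest_point (lattice_box l u) z = box_clamp l u z"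
proof -
  let ?c = "closest_point (lattice_box l u) z" and ?y = "box_clamp l u z"
  have "closed (lattice_box l u)" using fin by (rule finite_imp_closed)
  then have c: "?c \<in> lattice_box l u" and "dist z ?c \<le> dist z ?y"
    using x box_clamp_in_lattice_box[OF x z] closest_point_exists[of "lattice_box l u" z] by auto
  then have le: "(norm (?c - z))\<^sup>2 \<le> (norm (?y - z))\<^sup>2"
    by (simp add: dist_norm norm_minus_commute power_mono)
  \<comment> \<open>\<open>?y\<close> sees \<open>z\<close> and any point of the box under an obtuse angle, coordinate by coordinate.\<close>
  have "0 \<le> (?c - ?y) \<bullet> (?y - z)"
    unfolding inner_vec_def
  proof (rule sum_nonneg)
    fix i
    have "of_int \<lceil>l $ i\<rceil> \<le> ?c $ i" "?c $ i \<le> of_int \<lfloor>u $ i\<rfloor>"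
      using c by (auto simp: lattice_box_iff)
    then show "0 \<le> (?c - ?y) $ i \<bullet> (?y - z) $ i"
      by (auto simp: box_clamp_def max_def min_def mult_nonpos_nonpos)
  qed
  moreover have "(norm (?c - z))\<^sup>2 = (norm (?c - ?y))\<^sup>2 + (norm (?y - z))\<^sup>2
      + 2 * ((?c - ?y) \<bullet> (?y - z))"
    unfolding power2_norm_eq_inner by (simp add: inner_diff inner_commute)
  ultimately have "(norm (?c - ?y))\<^sup>2 \<le> 0" using le by linarith
  then show ?thesis by simp
qed

section \<open>The synchronous coupling\<close>

text \<open>The extra event \<open>Z\<close> lets one statement serve both for the marginals of a
  joint law and, with \<open>Z\<close> true, for the total mass.\<close>

lemma (in prob_space) sum_prob_image:
  assumes "finite S" "\<And>y. y \<in> S \<Longrightarrow> {\<omega> \<in> space M. Z \<omega> \<and> Y \<omega> = y} \<in> events"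
    "\<And>\<omega>. \<omega> \<in> space M \<Longrightarrow> Y \<omega> \<in> S"
  shows "(\<Sum>y\<in>S. \<P>(\<omega> in M. Z \<omega> \<and> Y \<omega> = y)) = \<P>(\<omega> in M. Z \<omega>)"
proof -
  have "(\<Sum>y\<in>S. \<P>(\<omega> in M. Z \<omega> \<and> Y \<omega> = y)) = prob (\<Union>y\<in>S. {\<omega> \<in> space M. Z \<omega> \<and> Y \<omega> = y})"
    using assms by (intro finite_measure_finite_Union[symmetric]) (auto simp: disjoint_family_on_def)
  also have "(\<Union>y\<in>S. {\<omega> \<in> space M. Z \<omega> \<and> Y \<omega> = y}) = {\<omega> \<in> space M. Z \<omega>}"
    using assms(3) by auto
  finally show ?thesis .
qed

text \<open>The joint law of \<open>X\<close> and \<open>Y\<close> is a coupling that gives no mass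
  to pairs at distance above \<open>d\<close>.\<close>

lemma (in prob_space) wasserstein1_laws_le:
  assumes S: "finite S"
    and X: "X \<in> measurable M (count_space S)" and Y: "Y \<in> measurable M (count_space S)"
    and d: "\<And>\<omega>. \<omega> \<in> space M \<Longrightarrow> dist (X \<omega>) (Y \<omega>) \<le> d"
  shows "wasserstein1 S (\<lambda>y. \<P>(\<omega> in M. X \<omega> = y)) (\<lambda>y. \<P>(\<omega> in M. Y \<omega> = y)) \<le> d"
proof -
  let ?\<gamma> = "\<lambda>x y. \<P>(\<omega> in M. X \<omega> = x \<and> Y \<omega> = y)"
  have XS: "X \<omega> \<in> S" and YS: "Y \<omega> \<in> S" if "\<omega> \<in> space M" for \<omega>
    using that measurable_space[OF X] measurable_space[OF Y] by auto
  have ev1: "{\<omega> \<in> space M. Z \<omega> = x} \<in> events" if Z: "Z \<in> measurable M (count_space S)" for Z x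
  proof -
    \<comment> \<open>Intersecting with \<open>S\<close> also covers \<open>x\<close> outside
      \<open>S\<close>, where the event is empty.\<close>
    have eq: "{\<omega> \<in> space M. Z \<omega> = x} = Z -` ({x} \<inter> S) \<inter> space M"
      using measurable_space[OF Z] by auto
    show ?thesis unfolding eq by (rule measurable_sets[OF Z]) simp
  qed
  have ev: "{\<omega> \<in> space M. X \<omega> = x \<and> Y \<omega> = y} \<in> events" for x y
    using sets.sets_Collect_conj[OF ev1[OF Y] ev1[OF X]] .
  have rows: "(\<Sum>y\<in>S. ?\<gamma> x y) = \<P>(\<omega> in M. X \<omega> = x)" for x
    by (rule sum_prob_image[OF S, of "\<lambda>\<omega>. X \<omega> = x" Y]) (rule ev YS | assumption)+
  have cols: "(\<Sum>x\<in>S. ?\<gamma> x y) = \<P>(\<omega> in M. Y \<omega> = y)" for y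
    unfolding conj_commute[of "X _ = _"]
    by (rule sum_prob_image[OF S, of "\<lambda>\<omega>. Y \<omega> = y" X], subst conj_commute) (rule ev XS | assumption)+
  have total: "(\<Sum>x\<in>S. \<P>(\<omega> in M. X \<omega> = x)) = 1"
    using sum_prob_image[OF S, of "\<lambda>_. True" X, unfolded simp_thms, OF ev1[OF X] XS]
    by (simp add: prob_space)
  have "?\<gamma> \<in> couplings S (\<lambda>y. \<P>(\<omega> in M. X \<omega> = y)) (\<lambda>y. \<P>(\<omega> in M. Y \<omega> = y))"
    by (auto simp: couplings_def rows cols)
  then have "wasserstein1 S (\<lambda>y. \<P>(\<omega> in M. X \<omega> = y)) (\<lambda>y. \<P>(\<omega> in M. Y \<omega> = y)) \<le> cost S ?\<gamma>"
    by (rule wasserstein1_le_cost)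
  also have "\<dots> \<le> (\<Sum>x\<in>S. \<Sum>y\<in>S. d * ?\<gamma> x y)"
    unfolding cost_def
  proof (intro sum_mono)
    fix x y
    show "dist x y * ?\<gamma> x y \<le> d * ?\<gamma> x y"
    proof (cases "dist x y \<le> d")
      case True
      then show ?thesis by (simp add: mult_right_mono)
    next
      case False
      then have "{\<omega> \<in> space M. X \<omega> = x \<and> Y \<omega> = y} = {}" using d by auto
      then have "?\<gamma> x y = 0" by (simp only: measure_empty)
      then show ?thesis by simp
    qed
  qed
  also have "\<dots> = d" by (simp add: sum_distrib_left[symmetric] rows total)
  finally show ?thesis .
qed

theorem proposition18:
  fixes l u :: "real ^ 'n"
    and rate :: real
    and M :: "'w measure"
    and J :: "'w \<Rightarrow> real ^ 'n"
  assumes "card (lattice_box l u) \<ge> 2"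
    and "rate > 0"
    and "prob_space M"
    and "J \<in> measurable M (count_space int_lattice)"
  shows "min_coarse_ricci (lattice_box l u)
           (truncated_generator (lattice_box l u) rate M J) \<ge> 0"
proof -
  interpret prob_space M by fact
  let ?S = "lattice_box l u"
  let ?Q = "truncated_generator ?S rate M J"
  let ?X = "\<lambda>r \<omega>. closest_point ?S (r + J \<omega>)"
  define P where "P r y = \<P>(\<omega> in M. ?X r \<omega> = y)" for r y
  have S: "finite ?S" using assms(1) card.infinite by fastforce
  have lattice: "r + J \<omega> \<in> int_lattice" if "r \<in> ?S" "\<omega> \<in> space M" for r \<omega>
    using that measurable_space[OF assms(4)] by (auto simp: lattice_box_def int_lattice_def)
  have clamp: "?X r \<omega> = box_clamp l u (r + J \<omega>)" if "r \<in> ?S" "\<omega> \<in> space M" for r \<omega>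
    using closest_point_lattice_box[OF S that(1) lattice[OF that]] .
  have XS: "?X r \<omega> \<in> ?S" if "r \<in> ?S" "\<omega> \<in> space M" for r \<omega>
    using clamp[OF that] box_clamp_in_lattice_box[OF that(1) lattice[OF that]] by simp
  have X: "?X r \<in> measurable M (count_space ?S)" if r: "r \<in> ?S" for r
  proof (rule measurableI)
    fix A assume "A \<in> sets (count_space ?S)"
    have "?X r -` A \<inter> space M = J -` {z \<in> int_lattice. closest_point ?S (r + z) \<in> A} \<inter> space M"
      using measurable_space[OF assms(4)] by auto
    also have "\<dots> \<in> events" using assms(4) by (rule measurable_sets) auto
    finally show "?X r -` A \<inter> space M \<in> events" .
  qed (use XS r in simp)
  have ev: "{\<omega> \<in> space M. ?X r \<omega> = y} \<in> events" if "r \<in> ?S" "y \<in> ?S" for r y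
    using measurable_sets[OF X[OF that(1)], of "{y}"] that(2)
    by (simp add: vimage_def Int_def conj_commute)
  have sum_P: "sum (P r) ?S = 1" if "r \<in> ?S" for r
    using sum_prob_image[OF S, of "\<lambda>_. True" "?X r"] ev XS that by (simp add: P_def prob_space)
  have stoch: "stochastic_matrix ?S P"
    using S sum_P by unfold_locales (auto simp: prob_vec_def P_def)
  \<comment> \<open>Synchronous coupling: both chains use the same jump \<open>J \<omega>\<close>, a
    translation that preserves their distance, and the clamp does not increase it.\<close>
  have contr: "wasserstein1 ?S (P x) (P y) \<le> dist x y" if xy: "x \<in> ?S" "y \<in> ?S" for x y
    unfolding P_def
  proof (rule wasserstein1_laws_le[OF S X[OF xy(1)] X[OF xy(2)]])
    fix \<omega> assume "\<omega> \<in> space M"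
    then show "dist (?X x \<omega>) (?X y \<omega>) \<le> dist x y"
      using dist_box_clamp_le[of l u "x + J \<omega>" "y + J \<omega>"] xy by (simp add: clamp)
  qed
  \<comment> \<open>\<open>P\<close> counts jumps that the projection sends back to
    \<open>x\<close>, the generator does not; on the diagonal the two agree because row
    \<open>x\<close> of \<open>P\<close> sums to 1.\<close>
  have Q: "?Q x y = rate * (P x y - dirac_vec x y)" if "x \<in> ?S" "y \<in> ?S" for x y
  proof (cases "x = y")
    case True
    have "?Q x y = - (rate * (\<Sum>z\<in>?S - {x}. P x z))"
      using True by (simp add: truncated_generator_def Let_def P_def sum_distrib_left)
    also have "(\<Sum>z\<in>?S - {x}. P x z) = 1 - P x x"
      using sum.remove[OF S that(1), of "P x"] sum_P[OF that(1)] by simp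
    finally show ?thesis using True by (simp add: dirac_vec_def algebra_simps)
  next
    case False
    then show ?thesis by (simp add: truncated_generator_def Let_def P_def dirac_vec_def)
  qed
  let ?K = "{coarse_ricci ?S ?Q r s | r s. r \<in> ?S \<and> s \<in> ?S \<and> r \<noteq> s}"
  have "?K \<subseteq> (\<lambda>(r, s). coarse_ricci ?S ?Q r s) ` (?S \<times> ?S)" by auto
  then have "finite ?K" by (rule finite_subset) (use S in auto)
  \<comment> \<open>\<open>Min\<close> is meaningful only on a nonempty finite set; two distinct
    states supply a member.\<close>
  moreover have "?K \<noteq> {}"
  proof -
    have "\<not> is_singleton ?S" "?S \<noteq> {}"
      using assms(1) by (auto simp: is_singleton_altdef)
    then show ?thesis using is_singletonI'[of ?S] by blast
  qed
  ultimately show ?thesis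
    unfolding min_coarse_ricci_def
    using coarse_ricci_nonneg[OF stoch contr assms(2) Q] by (auto simp: Min_ge_iff)
qed

end
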